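(* Let $n\ge 1$ be an integer, $\mathcal{V}=\{1,\ldots,n\}$, let $r_i\in(0,1]$ for $i\in\mathcal{V}$, and let $r=\min_{i\in\mathcal{V}}r_i$. If $r\ge 0.5$, then for any initial opinions $x(0)\in[0,1]^n$, the heterogeneous Hegselmann-Krause system with confidence bounds $r_1,\ldots,r_n$ started from $x(0)$ converges in finite time.
   Context: Heterogeneous Hegselmann-Krause (HK) system: there are $n$ agents $\mathcal{V}=\{1,\ldots,n\}$; agent $i$ has confidence bound $r_i\in(0,1]$ and opinion $x_i(t)\in[0,1]$ at integer time $t\ge 0$. Given $x(0)\in[0,1]^n$, the opinions evolve synchronously by $$x_i(t+1)=\frac{1}{|\mathcal{N}_i(x(t))|}\sum_{j\in\mathcal{N}_i(x(t))}x_j(t),\qquad i\in\mathcal{V},$$ where $\mathcal{N}_i(x(t))=\{1\le j\le n : |x_j(t)-x_i(t)|\le r_i\}$ (so $i\in\mathcal{N}_i(x(t))$). The opinion $x_i(t)$ of agent $i$ converges in finite time if there exist $x_i^*\in[0,1]$ and a time $T\ge 0$ such that $x_i(t)=x_i^*$ for all $t\ge T$. The system converges in finite time if the opinion of every agent $i\in\mathcal{V}$ converges in finite time. *)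

theory Defs
  imports Complex_Main
begin

text \<open>
  The agents are \<open>{1..n}\<close>; \<open>r i\<close> is the confidence bound of agent \<open>i\<close>, and a profile of opinions
  is a function \<open>nat \<Rightarrow> real\<close> of which only the values on \<open>{1..n}\<close> are meaningful: the neighbour
  sets below contain agents only, so the opinions of agents never depend on values at other indices.
\<close>

definition HK_neighbours :: "nat \<Rightarrow> (nat \<Rightarrow> real) \<Rightarrow> (nat \<Rightarrow> real) \<Rightarrow> nat \<Rightarrow> nat set" where
  "HK_neighbours n r x i = {j \<in> {1..n}. \<bar>x j - x i\<bar> \<le> r i}"

definition HK_step :: "nat \<Rightarrow> (nat \<Rightarrow> real) \<Rightarrow> (nat \<Rightarrow> real) \<Rightarrow> nat \<Rightarrow> real" where
  "HK_step n r x i =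
     (1 / real (card (HK_neighbours n r x i))) * (\<Sum>j\<in>HK_neighbours n r x i. x j)"

primrec HK_opinion :: "nat \<Rightarrow> (nat \<Rightarrow> real) \<Rightarrow> (nat \<Rightarrow> real) \<Rightarrow> nat \<Rightarrow> nat \<Rightarrow> real" where
  "HK_opinion n r x0 0 = x0"
| "HK_opinion n r x0 (Suc t) = HK_step n r (HK_opinion n r x0 t)"

definition converges_in_finite_time :: "(nat \<Rightarrow> real) \<Rightarrow> bool" where
  "converges_in_finite_time y \<longleftrightarrow> (\<exists>c\<in>{0..1}. \<exists>T. \<forall>t\<ge>T. y t = c)"

definition HK_converges_in_finite_time :: "nat \<Rightarrow> (nat \<Rightarrow> real) \<Rightarrow> (nat \<Rightarrow> real) \<Rightarrow> bool" where
  "HK_converges_in_finite_time n r x0 \<longleftrightarrow>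
     (\<forall>i\<in>{1..n}. converges_in_finite_time (\<lambda>t. HK_opinion n r x0 t i))"

end

theory Submission
  imports Defs
begin

text \<open>
  Call a profile \<^emph>\<open>narrow\<close> if no agent sees two opinions that are more than \<open>1/2\<close> apart. The proof
  shows that all profiles are narrow from some time on, and that a narrow regime freezes.

  A profile that is not narrow costs spread. An agent \<open>i\<close> that sees two opinions more than \<open>1/2\<close>
  apart moves to an average that keeps a distance of at least \<open>1/(2n)\<close> from both ends of the interval
  \<open>[m, M]\<close> of current opinions. As \<open>M - m \<le> 1\<close>, the new opinion of \<open>i\<close> is within \<open>1/2\<close> of one
  of the ends, say of \<open>m\<close>. With confidence bounds of at least \<open>1/2\<close>, no agent can then be unaware of
  \<open>i\<close> because \<open>i\<close> is too far to the right: every agent either sees \<open>i\<close>, or sees only opinions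
  above that of \<open>i\<close>. So after one more step all opinions are at least \<open>m + 1/(2n\<^sup>2)\<close>
  (lemma \<open>spread_two_steps_not_narrow\<close>). The spread never grows and is never negative, hence only
  finitely many profiles are not narrow (lemma \<open>eventually_narrow\<close>).

  In a narrow profile an agent sees exactly the agents within distance \<open>1/2\<close>, and visibility is an
  equivalence relation. The agents of a class compute the same average, so they stay together:
  neighbourhoods only grow (lemma \<open>neighbours_grow\<close>). They are subsets of a finite set, so the
  neighbourhood of each agent is eventually constant, and from then on the agent averages over
  opinions that all equal its own.
\<close>

section \<open>Averages over neighbourhoods\<close>

text \<open>
  The other members of \<open>A\<close> contribute at least \<open>m\<close> each, and the excess of \<open>i\<close> over \<open>m\<close> is diluted
  by a factor of at most \<open>n\<close>.
\<close>

lemma average_ge: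
  fixes x :: "'a \<Rightarrow> real"
  assumes "finite A" "card A \<le> n" "i \<in> A" "\<And>j. j \<in> A \<Longrightarrow> m \<le> x j"
  shows "m + (x i - m) / real n \<le> (1 / real (card A)) * sum x A"
proof -
  have pos: "0 < card A"
    using assms(1,3) by (auto simp: card_gt_0_iff)
  have "x i - m \<le> (\<Sum>j\<in>A. x j - m)"
    using assms by (intro member_le_sum) auto
  then have excess: "x i - m \<le> sum x A - real (card A) * m"
    by (simp add: sum_subtractf)
  have "(x i - m) / real n \<le> (x i - m) / real (card A)"
    using assms pos by (intro divide_left_mono) auto
  also have "\<dots> \<le> (sum x A - real (card A) * m) / real (card A)"
    using excess by (intro divide_right_mono) auto
  also have "\<dots> = (1 / real (card A)) * sum x A - m"
    using pos by (simp add: field_simps)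
  finally show ?thesis by simp
qed

lemma finite_HK_neighbours [simp]: "finite (HK_neighbours n r x i)"
  by (simp add: HK_neighbours_def)

lemma HK_neighbours_subset: "HK_neighbours n r x i \<subseteq> {1..n}"
  by (auto simp: HK_neighbours_def)

lemma card_HK_neighbours_le: "card (HK_neighbours n r x i) \<le> n"
  using card_mono[OF _ HK_neighbours_subset] by fastforce

lemma HK_step_ge_of_neighbour:
  assumes "j \<in> HK_neighbours n r x i"
    and "\<And>k. k \<in> HK_neighbours n r x i \<Longrightarrow> m \<le> x k"
  shows "m + (x j - m) / real n \<le> HK_step n r x i"
  unfolding HK_step_def using assms by (intro average_ge card_HK_neighbours_le) auto

text \<open>The reflection of the line, which turns each bound from below into one from above.\<close>

lemma HK_neighbours_uminus: "HK_neighbours n r (\<lambda>i. - x i) = HK_neighbours n r x"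
  by (force simp: HK_neighbours_def fun_eq_iff)

lemma HK_step_uminus: "HK_step n r (\<lambda>i. - x i) i = - HK_step n r x i"
  by (simp add: HK_step_def HK_neighbours_uminus sum_negf)

lemma HK_step_le_of_neighbour:
  assumes "j \<in> HK_neighbours n r x i"
    and "\<And>k. k \<in> HK_neighbours n r x i \<Longrightarrow> x k \<le> M"
  shows "HK_step n r x i \<le> M - (M - x j) / real n"
  using HK_step_ge_of_neighbour[of j n r "\<lambda>i. - x i" i "- M"] assms
  by (simp add: HK_neighbours_uminus HK_step_uminus)

lemma HK_step_const:
  assumes "i \<in> HK_neighbours n r x i"
    and "\<And>j. j \<in> HK_neighbours n r x i \<Longrightarrow> x j = c"
  shows "HK_step n r x i = c"
  using HK_step_ge_of_neighbour[of i n r x i c] HK_step_le_of_neighbour[of i n r x i c] assms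
  by auto

section \<open>Spread of the opinions\<close>

definition spread :: "nat \<Rightarrow> (nat \<Rightarrow> real) \<Rightarrow> real" where
  "spread n x = Max (x ` {1..n}) - Min (x ` {1..n})"

lemma spread_le:
  assumes "n \<ge> 1" "\<And>i. i \<in> {1..n} \<Longrightarrow> m \<le> x i \<and> x i \<le> M"
  shows "spread n x \<le> M - m"
proof -
  have "Max (x ` {1..n}) \<le> M" "m \<le> Min (x ` {1..n})"
    using assms by auto
  then show ?thesis by (simp add: spread_def)
qed

lemma spread_nonneg:
  assumes "n \<ge> 1"
  shows "0 \<le> spread n x"
proof -
  have "Min (x ` {1..n}) \<le> x 1" "x 1 \<le> Max (x ` {1..n})"
    using assms by auto
  then show ?thesis by (simp add: spread_def)
qed

definition narrow :: "nat \<Rightarrow> (nat \<Rightarrow> real) \<Rightarrow> (nat \<Rightarrow> real) \<Rightarrow> bool" where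
  "narrow n r x \<longleftrightarrow>
     (\<forall>i\<in>{1..n}. \<forall>j\<in>HK_neighbours n r x i. \<forall>k\<in>HK_neighbours n r x i. \<bar>x j - x k\<bar> \<le> 1 / 2)"

context
  fixes n :: nat and r :: "nat \<Rightarrow> real"
  assumes bound_ge_half: "\<And>i. i \<in> {1..n} \<Longrightarrow> 1 / 2 \<le> r i"
begin

lemma self_neighbour: "i \<in> {1..n} \<Longrightarrow> i \<in> HK_neighbours n r x i"
  using bound_ge_half[of i] by (auto simp: HK_neighbours_def)

lemma HK_step_bounds:
  assumes "i \<in> {1..n}" "\<And>j. j \<in> {1..n} \<Longrightarrow> m \<le> x j \<and> x j \<le> M"
  shows "m \<le> HK_step n r x i \<and> HK_step n r x i \<le> M"
proof -
  have "m + (x i - m) / real n \<le> HK_step n r x i" "HK_step n r x i \<le> M - (M - x i) / real n"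
    using assms HK_neighbours_subset[of n r x i]
    by (auto intro!: HK_step_ge_of_neighbour HK_step_le_of_neighbour self_neighbour)
  moreover have "0 \<le> (x i - m) / real n" "0 \<le> (M - x i) / real n"
    using assms by auto
  ultimately show ?thesis by linarith
qed

text \<open>
  A single agent near the minimum \<open>m\<close> but above it lifts everybody. An agent \<open>k\<close> that sees \<open>i\<close>
  has the excess of \<open>i\<close> in its average. The view of \<open>k\<close> reaches at least up to \<open>m + 1/2\<close>, so if
  \<open>k\<close> misses \<open>i\<close>, then all that \<open>k\<close> sees lies to the right of \<open>i\<close>.
\<close>

lemma HK_step_ge_of_agent_near_min:
  assumes lower: "\<And>j. j \<in> {1..n} \<Longrightarrow> m \<le> x j"
    and i: "i \<in> {1..n}" "x i \<le> m + 1 / 2" and k: "k \<in> {1..n}"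
  shows "m + (x i - m) / real n \<le> HK_step n r x k"
proof (cases "i \<in> HK_neighbours n r x k")
  case True
  then show ?thesis
    using lower HK_neighbours_subset[of n r x k] by (intro HK_step_ge_of_neighbour) auto
next
  case False
  have "m \<le> x k" "1 / 2 \<le> r k"
    using lower k bound_ge_half by auto
  with False i have right: "x i < x k - r k"
    by (auto simp: HK_neighbours_def)
  have above: "x i \<le> x j" if "j \<in> HK_neighbours n r x k" for j
    using that right by (auto simp: HK_neighbours_def abs_le_iff)
  have "x i + (x k - x i) / real n \<le> HK_step n r x k"
    using above k by (intro HK_step_ge_of_neighbour self_neighbour) auto
  moreover have "0 \<le> (x k - x i) / real n"
    using above[OF self_neighbour[OF k]] by simp
  moreover have "(x i - m) / real n \<le> x i - m"
    using lower[OF i(1)] i(1) by (simp add: divide_le_eq mult_le_cancel_left1)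
  ultimately show ?thesis by linarith
qed

lemma HK_step_le_of_agent_near_max:
  assumes upper: "\<And>j. j \<in> {1..n} \<Longrightarrow> x j \<le> M"
    and i: "i \<in> {1..n}" "M - 1 / 2 \<le> x i" and k: "k \<in> {1..n}"
  shows "HK_step n r x k \<le> M - (M - x i) / real n"
  using HK_step_ge_of_agent_near_min[of "- M" "\<lambda>j. - x j" i k] assms
  by (simp add: HK_step_uminus)

section \<open>Profiles that are not narrow lose spread\<close>

text \<open>
  Of two opinions in \<open>[m, M]\<close> that are more than \<open>1/2\<close> apart, the larger exceeds \<open>m\<close> by more than
  \<open>1/2\<close> and the smaller stays below \<open>M\<close> by more than \<open>1/2\<close>; averaging keeps an \<open>n\<close>-th of
  either gap.
\<close>

lemma HK_step_interior_of_far_neighbours: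
  assumes bounds: "\<And>j. j \<in> {1..n} \<Longrightarrow> m \<le> x j \<and> x j \<le> M"
    and far: "j \<in> HK_neighbours n r x i" "k \<in> HK_neighbours n r x i" "1 / 2 < x k - x j"
  shows "m + 1 / 2 / real n \<le> HK_step n r x i" "HK_step n r x i \<le> M - 1 / 2 / real n"
proof -
  have agents: "l \<in> {1..n}" if "l \<in> HK_neighbours n r x i" for l
    using that HK_neighbours_subset by blast
  have "1 / 2 / real n \<le> (x k - m) / real n" "1 / 2 / real n \<le> (M - x j) / real n"
    using bounds[OF agents[OF far(1)]] bounds[OF agents[OF far(2)]] far(3)
    by (intro divide_right_mono; simp)+
  moreover have "m + (x k - m) / real n \<le> HK_step n r x i"
    using far bounds agents by (intro HK_step_ge_of_neighbour) auto
  moreover have "HK_step n r x i \<le> M - (M - x j) / real n"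
    using far bounds agents by (intro HK_step_le_of_neighbour) auto
  ultimately show "m + 1 / 2 / real n \<le> HK_step n r x i" "HK_step n r x i \<le> M - 1 / 2 / real n"
    by linarith+
qed

text \<open>
  The first step brings one agent to distance at least \<open>1/(2n)\<close> from both ends. Which end moves in
  the second step depends on the half of \<open>[m, M]\<close> that this agent has reached; the loss
  \<open>1/(2n\<^sup>2)\<close> is the same for both.
\<close>

lemma spread_two_steps_not_narrow:
  assumes bounds: "\<And>j. j \<in> {1..n} \<Longrightarrow> m \<le> x j \<and> x j \<le> M" and width: "M - m \<le> 1"
    and not_narrow: "\<not> narrow n r x"
  shows "spread n (HK_step n r (HK_step n r x)) \<le> M - m - 1 / (2 * (real n)\<^sup>2)"
proof -
  define y where "y = HK_step n r x"
  obtain i j k where i: "i \<in> {1..n}"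
    and jk: "j \<in> HK_neighbours n r x i" "k \<in> HK_neighbours n r x i" "1 / 2 < \<bar>x j - x k\<bar>"
    using not_narrow unfolding narrow_def by force
  have interior: "m + 1 / 2 / real n \<le> y i" "y i \<le> M - 1 / 2 / real n"
  proof -
    consider "1 / 2 < x k - x j" | "1 / 2 < x j - x k"
      using jk(3) by linarith
    then show "m + 1 / 2 / real n \<le> y i" "y i \<le> M - 1 / 2 / real n"
      using HK_step_interior_of_far_neighbours[of m x M j i k]
        HK_step_interior_of_far_neighbours[of m x M k i j] bounds jk(1,2)
      unfolding y_def by (cases; blast)+
  qed
  have n: "n \<ge> 1" using i by simp
  have y_bounds: "m \<le> y l \<and> y l \<le> M" if "l \<in> {1..n}" for l
    unfolding y_def by (rule HK_step_bounds[OF that bounds])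
  have z_bounds: "m \<le> HK_step n r y l \<and> HK_step n r y l \<le> M" if "l \<in> {1..n}" for l
    by (rule HK_step_bounds[OF that y_bounds])
  have gain: "1 / (2 * (real n)\<^sup>2) = 1 / 2 / real n / real n"
    by (simp add: power2_eq_square)
  consider "y i \<le> m + 1 / 2" | "M - 1 / 2 \<le> y i"
    using width by linarith
  then have "spread n (HK_step n r y) \<le> M - m - 1 / (2 * (real n)\<^sup>2)"
  proof cases
    case 1
    have "1 / 2 / real n / real n \<le> (y i - m) / real n"
      using interior by (intro divide_right_mono) auto
    then have "m + 1 / (2 * (real n)\<^sup>2) \<le> HK_step n r y l" if "l \<in> {1..n}" for l
      using HK_step_ge_of_agent_near_min[of m y i l] y_bounds i 1 that
      unfolding gain by fastforce
    then show ?thesis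
      using spread_le[of n "m + 1 / (2 * (real n)\<^sup>2)" "HK_step n r y" M] n z_bounds
      by fastforce
  next
    case 2
    have "1 / 2 / real n / real n \<le> (M - y i) / real n"
      using interior by (intro divide_right_mono) auto
    then have "HK_step n r y l \<le> M - 1 / (2 * (real n)\<^sup>2)" if "l \<in> {1..n}" for l
      using HK_step_le_of_agent_near_max[of y M i l] y_bounds i 2 that
      unfolding gain by fastforce
    then show ?thesis
      using spread_le[of n m "HK_step n r y" "M - 1 / (2 * (real n)\<^sup>2)"] n z_bounds
      by fastforce
  qed
  then show ?thesis by (simp add: y_def)
qed

lemma HK_opinion_bounds:
  assumes "\<And>j. j \<in> {1..n} \<Longrightarrow> m \<le> x0 j \<and> x0 j \<le> M" "i \<in> {1..n}"
  shows "m \<le> HK_opinion n r x0 t i \<and> HK_opinion n r x0 t i \<le> M"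
  using assms(2)
proof (induction t arbitrary: i)
  case 0
  then show ?case using assms(1) by simp
next
  case (Suc t)
  then show ?case using HK_step_bounds[of i m "HK_opinion n r x0 t" M] by simp
qed

text \<open>
  The spread is nonincreasing and nonnegative, hence convergent, so its loss over two steps tends to
  \<open>0\<close> and is eventually below the loss that a profile that is not narrow would cause.
\<close>

lemma eventually_narrow:
  assumes n: "n \<ge> 1" and x0: "\<And>j. j \<in> {1..n} \<Longrightarrow> m \<le> x0 j \<and> x0 j \<le> M" and width: "M - m \<le> 1"
  shows "\<forall>\<^sub>F t in sequentially. narrow n r (HK_opinion n r x0 t)"
proof -
  define D where "D t = spread n (HK_opinion n r x0 t)" for t
  have range: "Min (HK_opinion n r x0 t ` {1..n}) \<le> HK_opinion n r x0 t j \<and>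
      HK_opinion n r x0 t j \<le> Max (HK_opinion n r x0 t ` {1..n})" if "j \<in> {1..n}" for t j
    using that by auto
  have D_le: "D t \<le> 1" for t
  proof -
    have "spread n (HK_opinion n r x0 t) \<le> M - m"
      using n HK_opinion_bounds[OF x0] by (intro spread_le) auto
    with width show ?thesis by (simp add: D_def)
  qed
  have "decseq D"
  proof (rule decseq_SucI)
    fix t
    have "spread n (HK_step n r (HK_opinion n r x0 t)) \<le>
        Max (HK_opinion n r x0 t ` {1..n}) - Min (HK_opinion n r x0 t ` {1..n})"
      by (rule spread_le[OF n]) (rule HK_step_bounds, assumption, rule range)
    then show "D (Suc t) \<le> D t"
      by (simp add: D_def spread_def)
  qed
  then obtain L where L: "D \<longlonglongrightarrow> L"
    using decseq_convergent[of D 0] spread_nonneg[OF n] unfolding D_def by blast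
  have "(\<lambda>t. D t - D (t + 2)) \<longlonglongrightarrow> L - L"
    by (intro tendsto_diff L LIMSEQ_ignore_initial_segment)
  then have "\<forall>\<^sub>F t in sequentially. D t - D (t + 2) < 1 / (2 * (real n)\<^sup>2)"
    using n by (intro order_tendstoD(2)) auto
  then show ?thesis
  proof eventually_elim
    case (elim t)
    show ?case
    proof (rule ccontr)
      assume "\<not> narrow n r (HK_opinion n r x0 t)"
      then have "spread n (HK_step n r (HK_step n r (HK_opinion n r x0 t))) \<le>
          Max (HK_opinion n r x0 t ` {1..n}) - Min (HK_opinion n r x0 t ` {1..n})
            - 1 / (2 * (real n)\<^sup>2)"
        using range D_le[of t] by (intro spread_two_steps_not_narrow) (auto simp: D_def spread_def)
      then have "D (t + 2) \<le> D t - 1 / (2 * (real n)\<^sup>2)"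
        by (simp add: D_def spread_def)
      with elim show False by linarith
    qed
  qed
qed

section \<open>Narrow profiles freeze\<close>

text \<open>
  A neighbour lies within \<open>1/2\<close> because every agent sees itself, and conversely every agent within
  \<open>1/2\<close> is seen by the assumption on the confidence bounds. So in a narrow profile visibility is
  symmetric although the confidence bounds differ, and narrowness makes it transitive.
\<close>

lemma narrow_neighbours_eq:
  assumes "narrow n r x" "i \<in> {1..n}" "j \<in> HK_neighbours n r x i"
  shows "HK_neighbours n r x j = HK_neighbours n r x i"
proof -
  have near: "l \<in> HK_neighbours n r x i \<longleftrightarrow> l \<in> {1..n} \<and> \<bar>x l - x i\<bar> \<le> 1 / 2"
    if "i \<in> {1..n}" for i l
    using assms(1) that self_neighbour[OF that, of x] bound_ge_half[OF that]
    unfolding narrow_def by (force simp: HK_neighbours_def)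
  have j: "j \<in> {1..n}"
    using assms(3) HK_neighbours_subset by blast
  have "i \<in> HK_neighbours n r x j"
    using assms near j by (simp add: abs_minus_commute)
  then show ?thesis
    using assms near j unfolding narrow_def by blast
qed

lemma narrow_HK_step_eq:
  assumes "narrow n r x" "i \<in> {1..n}" "j \<in> HK_neighbours n r x i"
  shows "HK_step n r x j = HK_step n r x i"
  using narrow_neighbours_eq[OF assms] by (simp add: HK_step_def)

text \<open>Agents that see each other move to the same opinion, and so keep seeing each other.\<close>

lemma neighbours_grow:
  assumes "narrow n r x" "i \<in> {1..n}"
  shows "HK_neighbours n r x i \<subseteq> HK_neighbours n r (HK_step n r x) i"
proof
  fix j assume j: "j \<in> HK_neighbours n r x i"
  then show "j \<in> HK_neighbours n r (HK_step n r x) i"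
    using narrow_HK_step_eq[OF assms j] HK_neighbours_subset[of n r x i] bound_ge_half[OF assms(2)]
    by (auto simp: HK_neighbours_def)
qed

text \<open>
  After the step the old neighbours of \<open>i\<close> all hold the opinion of \<open>i\<close>. If no new ones have come
  into view, \<open>i\<close> averages a constant.
\<close>

lemma narrow_HK_step_fixed:
  assumes "narrow n r x" "i \<in> {1..n}"
    and "HK_neighbours n r (HK_step n r x) i = HK_neighbours n r x i"
  shows "HK_step n r (HK_step n r x) i = HK_step n r x i"
proof (rule HK_step_const)
  show "i \<in> HK_neighbours n r (HK_step n r x) i"
    by (rule self_neighbour[OF assms(2)])
  show "HK_step n r x j = HK_step n r x i" if "j \<in> HK_neighbours n r (HK_step n r x) i" for j
    using narrow_HK_step_eq[OF assms(1,2)] that unfolding assms(3) by blast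
qed

lemma increasing_sets_eventually_const:
  fixes N :: "nat \<Rightarrow> 'a set"
  assumes "finite A" "\<And>t. T \<le> t \<Longrightarrow> N t \<subseteq> A" "\<And>t. T \<le> t \<Longrightarrow> N t \<subseteq> N (Suc t)"
  shows "\<exists>S\<ge>T. \<forall>t\<ge>S. N t = N S"
proof -
  have "\<exists>S. T \<le> S \<and> (\<forall>t. T \<le> t \<longrightarrow> card (N t) \<le> card (N S))"
    by (rule ex_has_greatest_nat[of _ T _ "Suc (card A)"])
      (use assms(1,2) in \<open>auto simp: less_Suc_eq_le card_mono\<close>)
  then obtain S where S: "T \<le> S" "\<And>t. T \<le> t \<Longrightarrow> card (N t) \<le> card (N S)"
    by blast
  have "N t = N S" if "S \<le> t" for t
  proof -
    have "N S \<subseteq> N t"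
      using that
    proof (induction t rule: dec_induct)
      case (step t)
      then show ?case using assms(3)[of t] S(1) by auto
    qed simp
    moreover have "finite (N t)"
      using finite_subset[OF assms(2) assms(1)] S(1) that by simp
    moreover have "card (N t) \<le> card (N S)"
      using S that by simp
    ultimately show ?thesis
      by (metis card_seteq)
  qed
  with S(1) show ?thesis by blast
qed

lemma eventually_const_of_eventually_narrow:
  assumes "\<forall>\<^sub>F t in sequentially. narrow n r (HK_opinion n r x0 t)" and i: "i \<in> {1..n}"
  shows "\<exists>T. \<forall>t\<ge>T. HK_opinion n r x0 t i = HK_opinion n r x0 T i"
proof -
  obtain T where T: "\<And>t. T \<le> t \<Longrightarrow> narrow n r (HK_opinion n r x0 t)"
    using assms(1) by (auto simp: eventually_sequentially)
  define N where "N t = HK_neighbours n r (HK_opinion n r x0 t) i" for t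
  obtain S where S: "T \<le> S" "\<And>t. S \<le> t \<Longrightarrow> N t = N S"
    using increasing_sets_eventually_const[of "{1..n}" T N] HK_neighbours_subset
      neighbours_grow[OF T i] by (auto simp: N_def)
  have still: "HK_opinion n r x0 (Suc (Suc t)) i = HK_opinion n r x0 (Suc t) i" if "S \<le> t" for t
    using narrow_HK_step_fixed[OF T i] S(1) that S(2)[of t] S(2)[of "Suc t"] by (simp add: N_def)
  have "HK_opinion n r x0 t i = HK_opinion n r x0 (Suc S) i" if "Suc S \<le> t" for t
    using that
  proof (induction t rule: dec_induct)
    case (step t)
    then obtain u where u: "t = Suc u" "S \<le> u"
      by (cases t) auto
    then show ?case using still[of u] step.IH by metis
  qed simp
  then show ?thesis by blast
qed

end

theorem corollary3p3:
  fixes n :: nat and r x0 :: "nat \<Rightarrow> real"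
  assumes "n \<ge> 1"
    and "\<And>i. i \<in> {1..n} \<Longrightarrow> r i \<in> {0<..1}"
    and "Min (r ` {1..n}) \<ge> 1 / 2"
    and "\<And>i. i \<in> {1..n} \<Longrightarrow> x0 i \<in> {0..1}"
  shows "HK_converges_in_finite_time n r x0"
  unfolding HK_converges_in_finite_time_def
proof
  fix i assume i: "i \<in> {1..n}"
  have r: "1 / 2 \<le> r j" if "j \<in> {1..n}" for j
  proof -
    have "Min (r ` {1..n}) \<le> r j"
      using that by (intro Min_le) auto
    with assms(3) show ?thesis by linarith
  qed
  have x0: "0 \<le> x0 j \<and> x0 j \<le> 1" if "j \<in> {1..n}" for j
    using assms(4)[OF that] by auto
  have "\<forall>\<^sub>F t in sequentially. narrow n r (HK_opinion n r x0 t)"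
    by (rule eventually_narrow[where m = 0 and M = 1]) (use r assms(1) x0 in auto)
  then obtain T where T: "\<And>t. T \<le> t \<Longrightarrow> HK_opinion n r x0 t i = HK_opinion n r x0 T i"
    using eventually_const_of_eventually_narrow[of n r x0 i] r i by blast
  moreover have "HK_opinion n r x0 T i \<in> {0..1}"
    using HK_opinion_bounds[of n r 0 x0 1 i T] r x0 i by simp
  ultimately show "converges_in_finite_time (\<lambda>t. HK_opinion n r x0 t i)"
    unfolding converges_in_finite_time_def by blast
qed

end
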